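(* Let $k=k(n)$ be a function of $n$ with $k(n)/(2^n n)\to\infty$ as $n\to\infty$. Let $f(n,k)$ be the fraction of $n$-tuples $(B_1,\dots,B_n)$ of subsets of $\{1,\dots,k\}$ (among all $2^{nk}$ such tuples) for which the collection $\{B_1,\dots,B_n\}$ is $\frac12$-splittable. Then $f(n,k(n))\to1$ as $n\to\infty$.
   Context: A collection $\{B_1,\dots,B_n\}$ of finite sets is $\frac12$-splittable if there is a set $S$ with $|S\cap B_i|\in\{\lfloor |B_i|/2\rfloor,\lceil |B_i|/2\rceil\}$ for all $i$. *)

theory Defs
  imports Complex_Main "HOL-Library.FuncSet"
begin

text \<open>The members of the collection are meant to be finite sets; no finiteness of \<open>S\<close> is
  imposed, as only the intersections \<open>S \<inter> B\<close> matter.\<close>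

definition half_splittable :: "'a set set \<Rightarrow> bool" where
  "half_splittable \<B> \<longleftrightarrow>
     (\<exists>S. \<forall>B\<in>\<B>. int (card (S \<inter> B)) \<in> {\<lfloor>real (card B) / 2\<rfloor>, \<lceil>real (card B) / 2\<rceil>})"

text \<open>An \<open>n\<close>-tuple \<open>(B\<^sub>1, \<dots>, B\<^sub>n)\<close> is an extensional function on \<open>{1..n}\<close>, so that distinct
  functions are distinct tuples.\<close>

definition set_tuples :: "nat \<Rightarrow> nat \<Rightarrow> (nat \<Rightarrow> nat set) set" where
  "set_tuples n k = ({1..n} \<rightarrow>\<^sub>E Pow {1..k})"

lemma card_set_tuples: "card (set_tuples n k) = 2 ^ (n * k)"
  by (simp add: set_tuples_def card_PiE card_Pow mult.commute flip: power_mult)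

definition splittable_fraction :: "nat \<Rightarrow> nat \<Rightarrow> real" where
  "splittable_fraction n k =
     real (card {B \<in> set_tuples n k. half_splittable (B ` {1..n})}) / real (card (set_tuples n k))"

end

theory Submission
  imports Defs
begin

text \<open>Let the private part of \<open>B\<^sub>i\<close> consist of the points lying in \<open>B\<^sub>i\<close> and in no other member.
  Start from the fractional set of constant weight \<open>1/2\<close> on the points outside all private parts.
  As long as more than \<open>n\<close> weights are fractional, some nonzero direction keeps all \<open>n\<close> sums over
  the \<open>B\<^sub>i\<close> and can be followed until a further weight becomes \<open>0\<close> or \<open>1\<close>. Rounding the at most \<open>n\<close>
  remaining fractional weights halves every \<open>B\<^sub>i\<close> up to an error of \<open>n\<close>, and this error can be
  corrected for each \<open>i\<close> separately inside the private part of \<open>B\<^sub>i\<close> if that has more than \<open>2n\<close>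
  points. The size of a private part is binomial with mean \<open>\<mu> = k/2\<^sup>n\<close>, so by Chebyshev's inequality
  some private part is too small with probability at most \<open>4n/\<mu>\<close>, which tends to \<open>0\<close>.\<close>

section \<open>Linear algebra and the rounding of fractional weights\<close>

text \<open>Gaussian elimination: a nonzero entry \<open>a j p\<close> serves as pivot, and clearing
  column \<open>p\<close> with row \<open>j\<close> leaves one equation and one unknown
  fewer.\<close>

lemma nontrivial_kernel:
  fixes a :: "'i \<Rightarrow> 'x \<Rightarrow> real"
  assumes "finite I" "finite F" "card I < card F"
  shows "\<exists>y. (\<exists>x\<in>F. y x \<noteq> 0) \<and> (\<forall>i\<in>I. (\<Sum>x\<in>F. a i x * y x) = 0)"
  using assms
proof (induction I arbitrary: F a rule: finite_induct)
  case empty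
  then obtain x where "x \<in> F" by fastforce
  then show ?case by (intro exI[of _ "\<lambda>_. 1"]) auto
next
  case (insert j I)
  show ?case
  proof (cases "\<forall>x\<in>F. a j x = 0")
    case True
    obtain y where "\<exists>x\<in>F. y x \<noteq> 0" "\<forall>i\<in>I. (\<Sum>x\<in>F. a i x * y x) = 0"
      using insert.IH[of F a] insert.prems insert.hyps by auto
    with True show ?thesis by (intro exI[of _ y]) auto
  next
    case False
    then obtain p where p: "p \<in> F" "a j p \<noteq> 0" by blast
    define b where "b = (\<lambda>i x. a i x - a i p / a j p * a j x)"
    have "card I < card (F - {p})"
      using insert.prems insert.hyps p by (simp add: card_Diff_singleton)
    with insert.IH[of "F - {p}" b] insert.prems obtain y where
      y: "\<exists>x\<in>F - {p}. y x \<noteq> 0" "\<forall>i\<in>I. (\<Sum>x\<in>F - {p}. b i x * y x) = 0"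
      by auto
    define s where "s = (\<Sum>x\<in>F - {p}. a j x * y x)"
    \<comment> \<open>The value at \<open>p\<close> is the one that solves equation
      \<open>j\<close>; with it, \<open>z\<close> solves row \<open>i\<close> of \<open>a\<close>
      exactly when \<open>y\<close> solves row \<open>i\<close> of \<open>b\<close>.\<close>
    define z where "z = y(p := - s / a j p)"
    have sum_z: "(\<Sum>x\<in>F. a i x * z x) = (\<Sum>x\<in>F - {p}. a i x * y x) - a i p / a j p * s" for i
    proof -
      have "(\<Sum>x\<in>F. a i x * z x) = a i p * z p + (\<Sum>x\<in>F - {p}. a i x * z x)"
        using insert.prems p by (simp add: sum.remove)
      also have "(\<Sum>x\<in>F - {p}. a i x * z x) = (\<Sum>x\<in>F - {p}. a i x * y x)"
        by (intro sum.cong) (auto simp: z_def)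
      finally show ?thesis by (simp add: z_def)
    qed
    have sum_b: "(\<Sum>x\<in>F - {p}. b i x * y x) = (\<Sum>x\<in>F - {p}. a i x * y x) - a i p / a j p * s" for i
      by (simp add: b_def s_def left_diff_distrib sum_subtractf sum_distrib_left mult.assoc)
    have "\<exists>x\<in>F. z x \<noteq> 0" using y(1) by (auto simp: z_def)
    moreover have "(\<Sum>x\<in>F. a i x * z x) = 0" if "i \<in> insert j I" for i
    proof (cases "i = j")
      case True
      then show ?thesis using p by (simp add: sum_z s_def)
    next
      case False
      then show ?thesis using that y(2) sum_z sum_b by simp
    qed
    ultimately show ?thesis by blast
  qed
qed

text \<open>All weights move from \<open>w\<close> with velocity \<open>y\<close>; \<open>t\<close>
  is the first time at which one of them reaches an end of the unit interval.\<close>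

lemma move_to_boundary:
  fixes w y :: "'x \<Rightarrow> real"
  assumes "finite F" and w: "\<And>x. x \<in> F \<Longrightarrow> 0 < w x \<and> w x < 1" and y: "\<exists>x\<in>F. y x \<noteq> 0"
  obtains t p where "\<And>x. x \<in> F \<Longrightarrow> 0 \<le> w x + t * y x \<and> w x + t * y x \<le> 1"
    and "p \<in> F" "w p + t * y p \<in> {0, 1}"
proof -
  \<comment> \<open>\<open>r x\<close> is the time at which the weight of \<open>x\<close> hits 1 if
    it is increasing and 0 if it is decreasing; it is used for \<open>y x \<noteq> 0\<close>
    only.\<close>
  define r where "r x = (if y x > 0 then (1 - w x) / y x else w x / (- y x))" for x
  let ?F = "{x \<in> F. y x \<noteq> 0}"
  have "finite (r ` ?F)" "r ` ?F \<noteq> {}" using assms by auto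
  then have "Min (r ` ?F) \<in> r ` ?F" by (rule Min_in)
  then obtain p where p: "p \<in> ?F" "r p = Min (r ` ?F)" by auto
  have le: "r p \<le> r x" if "x \<in> ?F" for x using p that \<open>finite (r ` ?F)\<close> by simp
  have "r p > 0" using p(1) w[of p] by (auto simp: r_def divide_pos_neg)
  have "0 \<le> w x + r p * y x \<and> w x + r p * y x \<le> 1" if x: "x \<in> F" for x
  proof (cases "y x = 0")
    case True
    then show ?thesis using w[OF x] by simp
  next
    case False
    with le x have *: "r p \<le> r x" by simp
    show ?thesis
    proof (cases "y x > 0")
      case True
      with * have "r p * y x \<le> 1 - w x" by (simp add: r_def field_simps)
      moreover have "0 \<le> r p * y x" using True \<open>r p > 0\<close> by simp
      ultimately show ?thesis using w[OF x] by simp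
    next
      case neg: False
      with False have "y x < 0" by simp
      with * have "- (r p * y x) \<le> w x" by (simp add: r_def field_simps)
      moreover have "r p * y x \<le> 0" using \<open>y x < 0\<close> \<open>r p > 0\<close> by (simp add: mult_le_0_iff)
      ultimately show ?thesis using w[OF x] by simp
    qed
  qed
  moreover have "w p + r p * y p \<in> {0, 1}" using p(1) by (auto simp: r_def)
  ultimately show ?thesis using that p by blast
qed

text \<open>Induction on the number of fractional weights: the direction of motion is supported on
  these, so a weight that has become 0 or 1 stays fixed from then on.\<close>

lemma few_fractional_weights:
  fixes a :: "'i \<Rightarrow> 'x \<Rightarrow> real" and w :: "'x \<Rightarrow> real"
  assumes "finite I" "finite X" and "\<And>x. x \<in> X \<Longrightarrow> 0 \<le> w x \<and> w x \<le> 1"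
  shows "\<exists>v. (\<forall>x\<in>X. 0 \<le> v x \<and> v x \<le> 1) \<and>
           (\<forall>i\<in>I. (\<Sum>x\<in>X. a i x * v x) = (\<Sum>x\<in>X. a i x * w x)) \<and>
           card {x \<in> X. 0 < v x \<and> v x < 1} \<le> card I"
  using assms(3)
proof (induction "card {x \<in> X. 0 < w x \<and> w x < 1}" arbitrary: w rule: less_induct)
  case less
  let ?F = "{x \<in> X. 0 < w x \<and> w x < 1}"
  show ?case
  proof (cases "card ?F \<le> card I")
    case True
    with less.prems show ?thesis by blast
  next
    case False
    have fin: "finite ?F" using \<open>finite X\<close> by simp
    with nontrivial_kernel[OF \<open>finite I\<close>, of ?F a] False obtain y where
      y: "\<exists>x\<in>?F. y x \<noteq> 0" "\<forall>i\<in>I. (\<Sum>x\<in>?F. a i x * y x) = 0" by auto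
    obtain t p where t: "\<And>x. x \<in> ?F \<Longrightarrow> 0 \<le> w x + t * y x \<and> w x + t * y x \<le> 1"
      and p: "p \<in> ?F" "w p + t * y p \<in> {0, 1}"
      using move_to_boundary[OF fin _ y(1), of w] by auto
    define w' where "w' x = w x + (if x \<in> ?F then t * y x else 0)" for x
    have range: "0 \<le> w' x \<and> w' x \<le> 1" if "x \<in> X" for x
      using t[of x] less.prems[OF that] by (auto simp: w'_def)
    have "{x \<in> X. 0 < w' x \<and> w' x < 1} \<subset> ?F"
    proof
      show "{x \<in> X. 0 < w' x \<and> w' x < 1} \<subseteq> ?F" by (auto simp: w'_def split: if_splits)
      have "w' p \<in> {0, 1}" using p by (simp add: w'_def)
      then have "p \<notin> {x \<in> X. 0 < w' x \<and> w' x < 1}" by auto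
      with p(1) show "{x \<in> X. 0 < w' x \<and> w' x < 1} \<noteq> ?F" by metis
    qed
    then have "card {x \<in> X. 0 < w' x \<and> w' x < 1} < card ?F" by (rule psubset_card_mono[OF fin])
    from less.hyps[OF this range] obtain v where v: "\<forall>x\<in>X. 0 \<le> v x \<and> v x \<le> 1"
      "\<forall>i\<in>I. (\<Sum>x\<in>X. a i x * v x) = (\<Sum>x\<in>X. a i x * w' x)"
      "card {x \<in> X. 0 < v x \<and> v x < 1} \<le> card I" by blast
    have "(\<Sum>x\<in>X. a i x * w' x) = (\<Sum>x\<in>X. a i x * w x)" if "i \<in> I" for i
    proof -
      have "(\<Sum>x\<in>X. a i x * w' x)
          = (\<Sum>x\<in>X. a i x * w x) + (\<Sum>x\<in>X. if x \<in> ?F then t * (a i x * y x) else 0)"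
        by (simp add: w'_def distrib_left flip: sum.distrib) (intro sum.cong, auto)
      also have "(\<Sum>x\<in>X. if x \<in> ?F then t * (a i x * y x) else 0) = (\<Sum>x\<in>?F. t * (a i x * y x))"
        using \<open>finite X\<close> by (intro sum.mono_neutral_cong_right) auto
      also have "\<dots> = 0" using y(2) that by (simp flip: sum_distrib_left)
      finally show ?thesis by simp
    qed
    with v show ?thesis by (intro exI[of _ v]) auto
  qed
qed

text \<open>All fractional weights are rounded down, so the error is one-sided: \<open>S\<close>
  never takes more than half of \<open>Y \<inter> B i\<close>, and a later correction only has to
  add points.\<close>

lemma approximate_halving:
  fixes B :: "'i \<Rightarrow> 'x set"
  assumes "finite I" "finite Y"
  obtains S where "S \<subseteq> Y"
    and "\<And>i. i \<in> I \<Longrightarrow> real (card (S \<inter> B i)) \<le> real (card (Y \<inter> B i)) / 2"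
    and "\<And>i. i \<in> I \<Longrightarrow> real (card (Y \<inter> B i)) / 2 - real (card I) \<le> real (card (S \<inter> B i))"
proof -
  obtain v where v: "\<forall>x\<in>Y. 0 \<le> v x \<and> v x \<le> (1::real)"
      "\<forall>i\<in>I. (\<Sum>x\<in>Y. of_bool (x \<in> B i) * v x) = (\<Sum>x\<in>Y. of_bool (x \<in> B i) * (1/2))"
      "card {x \<in> Y. 0 < v x \<and> v x < 1} \<le> card I"
    using few_fractional_weights[OF assms, of "\<lambda>_. 1/2" "\<lambda>i x. of_bool (x \<in> B i)"] by auto
  let ?F = "{x \<in> Y. 0 < v x \<and> v x < 1}"
  define S where "S = {x \<in> Y. v x = 1}"
  have half: "(\<Sum>x\<in>Y. of_bool (x \<in> B i) * v x) = real (card (Y \<inter> B i)) / 2" if "i \<in> I" for i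
  proof -
    have "(\<Sum>x\<in>Y. of_bool (x \<in> B i) * (1/2)) = (\<Sum>x\<in>Y \<inter> B i. 1/2 :: real)"
      using \<open>finite Y\<close> by (intro sum.mono_neutral_cong_right) auto
    then show ?thesis using v(2) that by simp
  qed
  have S: "real (card (S \<inter> B i)) = (\<Sum>x\<in>Y. of_bool (x \<in> B i) * of_bool (v x = 1))" for i
  proof -
    have "(\<Sum>x\<in>Y. of_bool (x \<in> B i) * of_bool (v x = 1)) = (\<Sum>x\<in>S \<inter> B i. 1::real)"
      using \<open>finite Y\<close> by (intro sum.mono_neutral_cong_right) (auto simp: S_def)
    then show ?thesis by simp
  qed
  show ?thesis
  proof (rule that[of S])
    show "S \<subseteq> Y" by (auto simp: S_def)
    fix i assume i: "i \<in> I"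
    show "real (card (S \<inter> B i)) \<le> real (card (Y \<inter> B i)) / 2"
      unfolding S half[OF i, symmetric] using v(1) by (intro sum_mono mult_left_mono) auto
    \<comment> \<open>Rounding down loses at most 1 at each point of \<open>?F\<close> and nothing
      elsewhere, since \<open>v\<close> is 0 or 1 on the rest of \<open>Y\<close>.\<close>
    have "(\<Sum>x\<in>Y. of_bool (x \<in> B i) * v x)
        \<le> (\<Sum>x\<in>Y. of_bool (x \<in> B i) * of_bool (v x = 1) + of_bool (x \<in> ?F))"
    proof (intro sum_mono)
      fix x assume "x \<in> Y"
      then show "of_bool (x \<in> B i) * v x \<le> of_bool (x \<in> B i) * of_bool (v x = 1) + of_bool (x \<in> ?F)"
        using v(1) by (auto simp: order_less_le)
    qed
    also have "\<dots> = real (card (S \<inter> B i)) + real (card ?F)"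
    proof -
      have "(\<Sum>x\<in>Y. of_bool (x \<in> ?F)) = (\<Sum>x\<in>?F. 1::real)"
        using \<open>finite Y\<close> by (intro sum.mono_neutral_cong_right) auto
      then show ?thesis by (simp add: sum.distrib S)
    qed
    finally show "real (card (Y \<inter> B i)) / 2 - real (card I) \<le> real (card (S \<inter> B i))"
      using v(3) half[OF i] by simp
  qed
qed

section \<open>Correction inside the private parts\<close>

definition private_part :: "'i set \<Rightarrow> ('i \<Rightarrow> 'x set) \<Rightarrow> 'i \<Rightarrow> 'x set" where
  "private_part I B i = {x \<in> B i. \<forall>j\<in>I. j \<noteq> i \<longrightarrow> x \<notin> B j}"

text \<open>The deficit of \<open>S\<close> in \<open>B i\<close> is nonnegative and at most
  \<open>card I\<close> plus half the size of the private part. Once that size exceeds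
  \<open>2 * card I\<close>, the private part has enough points to make up the deficit.\<close>

lemma half_splittable_if_private_parts_large:
  fixes B :: "'i \<Rightarrow> 'x set"
  assumes I: "finite I" and B: "\<And>i. i \<in> I \<Longrightarrow> finite (B i)"
    and large: "\<And>i. i \<in> I \<Longrightarrow> 2 * card I < card (private_part I B i)"
  shows "half_splittable (B ` I)"
proof -
  let ?R = "private_part I B"
  \<comment> \<open>These are the points covered by at least two members.\<close>
  define Y where "Y = (\<Union>i\<in>I. B i) - (\<Union>i\<in>I. ?R i)"
  have "finite Y" using I B by (auto simp: Y_def)
  from approximate_halving[OF I this, of B] obtain S where S: "S \<subseteq> Y"
    "\<And>i. i \<in> I \<Longrightarrow> real (card (S \<inter> B i)) \<le> real (card (Y \<inter> B i)) / 2"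
    "\<And>i. i \<in> I \<Longrightarrow> real (card (Y \<inter> B i)) / 2 - real (card I) \<le> real (card (S \<inter> B i))"
    by blast
  have "\<exists>T. T \<subseteq> ?R i \<and> card T + card (S \<inter> B i) = card (B i) div 2" if i: "i \<in> I" for i
  proof -
    have fin: "finite (?R i)" using B[OF i] by (auto simp: private_part_def)
    \<comment> \<open>Since \<open>B i\<close> meets no private part but its own, it is the disjoint
      union of \<open>Y \<inter> B i\<close> and \<open>?R i\<close>.\<close>
    have "j = i" if "j \<in> I" "x \<in> B i" "x \<in> ?R j" for x j
    proof -
      from that(3) i have "i \<noteq> j \<longrightarrow> x \<notin> B i" by (simp add: private_part_def)
      with that(2) show ?thesis by auto
    qed
    moreover have "?R i \<subseteq> B i" by (auto simp: private_part_def)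
    ultimately have "B i = (Y \<inter> B i) \<union> ?R i" "(Y \<inter> B i) \<inter> ?R i = {}"
      using i by (auto simp: Y_def)
    then have "card (B i) = card (Y \<inter> B i) + card (?R i)"
      using card_Un_disjoint[of "Y \<inter> B i" "?R i"] fin B[OF i] by simp
    with S(2,3)[OF i] large[OF i]
    have "card (S \<inter> B i) \<le> card (B i) div 2"
      "card (B i) div 2 - card (S \<inter> B i) \<le> card (?R i)" by linarith+
    then show ?thesis
      by (metis obtain_subset_with_card_n le_add_diff_inverse2)
  qed
  then obtain T where T: "\<And>i. i \<in> I \<Longrightarrow> T i \<subseteq> ?R i"
    "\<And>i. i \<in> I \<Longrightarrow> card (T i) + card (S \<inter> B i) = card (B i) div 2" by metis
  have "card ((S \<union> (\<Union>i\<in>I. T i)) \<inter> B i) = card (B i) div 2" if i: "i \<in> I" for i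
  proof -
    have disj: "T i \<inter> (S \<inter> B i) = {}" using T(1)[OF i] S(1) i by (auto simp: Y_def)
    have fin: "finite (T i)" "finite (S \<inter> B i)"
      using T(1)[OF i] B[OF i] by (auto simp: private_part_def intro: finite_subset)
    \<comment> \<open>The corrections made for the other indices lie outside
      \<open>B i\<close>.\<close>
    have "(S \<union> (\<Union>i\<in>I. T i)) \<inter> B i = T i \<union> (S \<inter> B i)"
      using T(1) i by (fastforce simp: private_part_def)
    then show ?thesis using card_Un_disjoint[OF fin disj] T(2)[OF i] by simp
  qed
  moreover have "int (m div 2) = \<lfloor>real m / 2\<rfloor>" for m :: nat by linarith
  ultimately show ?thesis unfolding half_splittable_def
    by (intro exI[of _ "S \<union> (\<Union>i\<in>I. T i)"]) simp
qed

section \<open>Counting tuples and the variance of the size of a private part\<close>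

text \<open>Such a set is determined by its part outside \<open>Z\<close>, which is
  arbitrary.\<close>

lemma card_subsets_with_trace:
  assumes "finite X" "Z \<subseteq> X" "W \<subseteq> Z"
  shows "card {A \<in> Pow X. A \<inter> Z = W} = 2 ^ (card X - card Z)"
proof -
  have "bij_betw (\<lambda>A. A \<union> W) (Pow (X - Z)) {A \<in> Pow X. A \<inter> Z = W}"
    using assms by (intro bij_betw_byWitness[where f' = "\<lambda>A. A - Z"]) auto
  then have "card {A \<in> Pow X. A \<inter> Z = W} = card (Pow (X - Z))"
    using bij_betw_same_card by fastforce
  then show ?thesis using assms by (simp add: card_Pow card_Diff_subset finite_subset)
qed

text \<open>The condition splits into one per coordinate: \<open>B i\<close> contains
  \<open>Z\<close>, and every other \<open>B j\<close> avoids it. Each fixes the trace on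
  \<open>Z\<close>.\<close>

lemma card_tuples_with_private_points:
  assumes "i \<in> {1..n}" "Z \<subseteq> {1..k}"
  shows "card {B \<in> set_tuples n k. Z \<subseteq> private_part {1..n} B i} = 2 ^ (n * (k - card Z))"
proof -
  have "{B \<in> set_tuples n k. Z \<subseteq> private_part {1..n} B i}
      = (\<Pi>\<^sub>E j\<in>{1..n}. {A \<in> Pow {1..k}. A \<inter> Z = (if j = i then Z else {})})"
    using assms unfolding set_tuples_def private_part_def PiE_iff set_eq_iff
    by (auto simp: PiE_iff split: if_splits; blast)
  then have "card {B \<in> set_tuples n k. Z \<subseteq> private_part {1..n} B i}
      = (\<Prod>j\<in>{1..n}. card {A \<in> Pow {1..k}. A \<inter> Z = (if j = i then Z else {})})"
    by (simp add: card_PiE)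
  also have "\<dots> = (\<Prod>j\<in>{1..n}. 2 ^ (k - card Z))"
    using assms by (intro prod.cong) (simp_all add: card_subsets_with_trace del: Pow_iff)
  finally show ?thesis by (simp add: mult.commute flip: power_mult)
qed

lemma finite_set_tuples: "finite (set_tuples n k)"
  by (simp add: set_tuples_def finite_PiE)

lemma private_part_subset:
  assumes "B \<in> set_tuples n k" "i \<in> {1..n}"
  shows "private_part {1..n} B i \<subseteq> {1..k}"
  using assms by (auto simp: set_tuples_def private_part_def PiE_iff)

text \<open>For a uniformly random tuple, the points of \<open>{1..k}\<close> are private to
  \<open>i\<close> independently, each with probability \<open>1 / 2 ^ n\<close>. Singletons and
  pairs \<open>Z\<close> give the first two moments.\<close>

lemma proportion_private_points:
  assumes "i \<in> {1..n}" "Z \<subseteq> {1..k}"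
  shows "(\<Sum>B\<in>set_tuples n k. of_bool (Z \<subseteq> private_part {1..n} B i))
    = real (2 ^ (n * k)) / 2 ^ (n * card Z)"
proof -
  have "card Z \<le> k" using card_mono[OF _ assms(2)] by simp
  then have "(2::real) ^ (n * (k - card Z)) * 2 ^ (n * card Z) = 2 ^ (n * k)"
    by (simp flip: power_add distrib_left)
  then show ?thesis
    using card_tuples_with_private_points[OF assms] finite_set_tuples[of n k]
    by (simp add: sum.If_cases of_bool_def Int_def field_simps)
qed

text \<open>This is the variance \<open>k * q * (1 - q) \<le> k * q\<close> of a binomial variable
  with \<open>q = 1 / 2 ^ n\<close>, multiplied by the number of tuples.\<close>

lemma second_moment_private_part:
  assumes i: "i \<in> {1..n}"
  shows "(\<Sum>B\<in>set_tuples n k. (real (card (private_part {1..n} B i)) - real k / 2 ^ n)\<^sup>2)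
    \<le> real (2 ^ (n * k)) * (real k / 2 ^ n)"
proof -
  let ?T = "set_tuples n k" and ?N = "real (2 ^ (n * k))" and ?q = "1 / 2 ^ n :: real"
  let ?R = "\<lambda>B. private_part {1..n} B i"
  define e :: "nat \<Rightarrow> (nat \<Rightarrow> nat set) \<Rightarrow> real" where "e x B = of_bool (x \<in> ?R B)" for x B
  have R: "real (card (?R B)) = (\<Sum>x\<in>{1..k}. e x B)" if "B \<in> ?T" for B
  proof -
    have "(\<Sum>x\<in>{1..k}. e x B) = (\<Sum>x\<in>?R B. 1::real)"
      using private_part_subset[OF that i] unfolding e_def
      by (intro sum.mono_neutral_cong_right) auto
    then show ?thesis by simp
  qed
  have e1: "(\<Sum>B\<in>?T. e x B) = ?N * ?q" if "x \<in> {1..k}" for x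
    using proportion_private_points[OF i, of "{x}" k] that by (simp add: e_def)
  \<comment> \<open>Distinct points give \<open>?q\<^sup>2\<close> by independence; on the diagonal
    the indicator is idempotent, and the second term replaces \<open>?q\<^sup>2\<close> by
    \<open>?q\<close>.\<close>
  have e2: "(\<Sum>B\<in>?T. e x B * e y B) = ?N * ?q\<^sup>2 + of_bool (x = y) * (?N * (?q - ?q\<^sup>2))"
    if "x \<in> {1..k}" "y \<in> {1..k}" for x y
  proof (cases "x = y")
    case True
    have "e x B * e x B = e x B" for B by (simp add: e_def)
    then show ?thesis using True e1[OF that(1)] by (simp only:) (simp add: algebra_simps)
  next
    case False
    have "e x B * e y B = of_bool ({x, y} \<subseteq> ?R B)" for B by (simp add: e_def)
    then show ?thesis using proportion_private_points[OF i, of "{x, y}" k] that False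
      by (simp add: power_mult power2_eq_square power_divide field_simps)
        (simp add: power_add mult_2_right)
  qed
  have M1: "(\<Sum>B\<in>?T. real (card (?R B))) = ?N * (real k * ?q)"
  proof -
    have "(\<Sum>B\<in>?T. real (card (?R B))) = (\<Sum>B\<in>?T. \<Sum>x\<in>{1..k}. e x B)"
      by (intro sum.cong refl R)
    also have "\<dots> = (\<Sum>x\<in>{1..k}. \<Sum>B\<in>?T. e x B)" by (rule sum.swap)
    finally show ?thesis by (simp add: e1)
  qed
  have M2: "(\<Sum>B\<in>?T. (real (card (?R B)))\<^sup>2) = ?N * ((real k * ?q)\<^sup>2 + real k * (?q - ?q\<^sup>2))"
  proof -
    have "(\<Sum>B\<in>?T. (real (card (?R B)))\<^sup>2)
        = (\<Sum>B\<in>?T. \<Sum>x\<in>{1..k}. \<Sum>y\<in>{1..k}. e x B * e y B)"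
      by (intro sum.cong refl) (simp only: R power2_eq_square sum_product)
    also have "\<dots> = (\<Sum>x\<in>{1..k}. \<Sum>y\<in>{1..k}. \<Sum>B\<in>?T. e x B * e y B)"
      by (subst sum.swap, intro sum.cong refl, subst sum.swap) simp
    also have "\<dots> = (\<Sum>x\<in>{1..k}. \<Sum>y\<in>{1..k}. ?N * ?q\<^sup>2 + of_bool (x = y) * (?N * (?q - ?q\<^sup>2)))"
      by (intro sum.cong refl e2)
    also have "\<dots> = (\<Sum>x\<in>{1..k}. real k * (?N * ?q\<^sup>2) + ?N * (?q - ?q\<^sup>2))"
    proof (intro sum.cong refl)
      fix x assume "x \<in> {1..k}"
      then have "(\<Sum>y\<in>{1..k}. of_bool (x = y) * c) = c" for c :: real
        by (simp add: of_bool_def if_distrib[of "\<lambda>b. b * c"] cong: if_cong)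
      then show "(\<Sum>y\<in>{1..k}. ?N * ?q\<^sup>2 + of_bool (x = y) * (?N * (?q - ?q\<^sup>2)))
          = real k * (?N * ?q\<^sup>2) + ?N * (?q - ?q\<^sup>2)"
        by (simp only: sum.distrib) simp
    qed
    finally show ?thesis by (simp add: power2_eq_square algebra_simps)
  qed
  have "(\<Sum>B\<in>?T. (real (card (?R B)) - real k * ?q)\<^sup>2)
      = (\<Sum>B\<in>?T. (real (card (?R B)))\<^sup>2) - 2 * (real k * ?q) * (\<Sum>B\<in>?T. real (card (?R B)))
        + ?N * (real k * ?q)\<^sup>2"
    by (simp add: power2_diff sum.distrib sum_subtractf sum_distrib_left card_set_tuples
        mult_ac)
  also have "\<dots> = ?N * (real k * (?q - ?q\<^sup>2))"
    unfolding M1 M2 by (simp add: power2_eq_square algebra_simps)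
  also have "\<dots> \<le> ?N * (real k * ?q)" by (intro mult_left_mono) auto
  finally show ?thesis by simp
qed

text \<open>Chebyshev's inequality: the mean is at least \<open>4 * n\<close>, so a size of at most
  \<open>2 * n\<close> deviates from it by at least half the mean.\<close>

lemma card_small_private_part:
  assumes i: "i \<in> {1..n}" and k: "4 * real n \<le> real k / 2 ^ n"
  shows "real (card {B \<in> set_tuples n k. card (private_part {1..n} B i) \<le> 2 * n})
    \<le> 4 * real (2 ^ (n * k)) / (real k / 2 ^ n)"
proof -
  let ?T = "set_tuples n k" and ?R = "\<lambda>B. private_part {1..n} B i" and ?m = "real k / 2 ^ n"
  let ?bad = "{B \<in> ?T. card (?R B) \<le> 2 * n}"
  have m: "?m > 0" using i k by (intro less_le_trans[OF _ k]) simp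
  have "real (card ?bad) * (?m / 2)\<^sup>2 = (\<Sum>B\<in>?bad. (?m / 2)\<^sup>2)" by simp
  also have "\<dots> \<le> (\<Sum>B\<in>?bad. (real (card (?R B)) - ?m)\<^sup>2)"
  proof (intro sum_mono)
    fix B assume "B \<in> ?bad"
    then have "?m / 2 \<le> ?m - real (card (?R B))" using k by auto
    then have "(?m / 2)\<^sup>2 \<le> (?m - real (card (?R B)))\<^sup>2" using m by (intro power_mono) auto
    then show "(?m / 2)\<^sup>2 \<le> (real (card (?R B)) - ?m)\<^sup>2" by (simp add: power2_commute)
  qed
  also have "\<dots> \<le> (\<Sum>B\<in>?T. (real (card (?R B)) - ?m)\<^sup>2)"
    by (intro sum_mono2 finite_set_tuples) auto
  also have "\<dots> \<le> real (2 ^ (n * k)) * ?m" by (rule second_moment_private_part[OF i])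
  finally have "real (card ?bad) * ?m * ?m \<le> 4 * real (2 ^ (n * k)) * ?m"
    by (simp add: power2_eq_square)
  then have "real (card ?bad) * ?m \<le> 4 * real (2 ^ (n * k))" using m by (rule mult_right_le_imp_le)
  then show ?thesis using m by (simp only: pos_le_divide_eq)
qed

section \<open>Bounds for the fraction and the limit\<close>

lemma splittable_fraction_le_1: "splittable_fraction n k \<le> 1"
  unfolding splittable_fraction_def
  by (rule divide_le_eq_1_pos[THEN iffD2], simp add: card_set_tuples)
    (use finite_set_tuples in \<open>auto intro: card_mono\<close>)

text \<open>Union bound over the \<open>n\<close> indices: a tuple that is bad for no index has all
  its private parts large. The factor \<open>n\<close> turns \<open>4 / (k / 2 ^ n)\<close> into the
  stated error.\<close>

lemma splittable_fraction_ge: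
  assumes "n > 0" and k: "4 \<le> real k / (2 ^ n * real n)"
  shows "1 - 4 / (real k / (2 ^ n * real n)) \<le> splittable_fraction n k"
proof -
  let ?T = "set_tuples n k" and ?N = "real (2 ^ (n * k))"
  let ?good = "{B \<in> ?T. half_splittable (B ` {1..n})}"
  let ?bad = "\<lambda>i. {B \<in> ?T. card (private_part {1..n} B i) \<le> 2 * n}"
  have k': "4 * real n \<le> real k / 2 ^ n" using k \<open>n > 0\<close> by (simp add: field_simps)
  have "B \<in> ?good" if B: "B \<in> ?T" "\<And>i. i \<in> {1..n} \<Longrightarrow> B \<notin> ?bad i" for B
  proof -
    have "finite (B i)" if "i \<in> {1..n}" for i
      using PiE_mem[OF B(1)[unfolded set_tuples_def] that] finite_subset by blast
    moreover have "2 * card {1..n} < card (private_part {1..n} B i)" if "i \<in> {1..n}" for i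
      using B(1) B(2)[OF that] by simp
    ultimately show ?thesis using half_splittable_if_private_parts_large[of "{1..n}" B] B(1) by simp
  qed
  then have sub: "?T \<subseteq> ?good \<union> (\<Union>i\<in>{1..n}. ?bad i)" by blast
  have fin: "finite (?good \<union> (\<Union>i\<in>{1..n}. ?bad i))" by (auto simp: finite_set_tuples)
  have "card ?T \<le> card ?good + card (\<Union>i\<in>{1..n}. ?bad i)"
    using card_mono[OF fin sub] card_Un_le order_trans by blast
  also have "\<dots> \<le> card ?good + (\<Sum>i\<in>{1..n}. card (?bad i))" by (simp add: card_UN_le)
  finally have "?N \<le> real (card ?good) + (\<Sum>i\<in>{1..n}. real (card (?bad i)))"
    unfolding card_set_tuples of_nat_sum[symmetric] of_nat_add[symmetric] of_nat_le_iff .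
  also have "\<dots> \<le> real (card ?good) + (\<Sum>i\<in>{1..n}. 4 * ?N / (real k / 2 ^ n))"
    by (intro add_left_mono sum_mono card_small_private_part k')
  finally have "?N \<le> real (card ?good) + ?N * (4 / (real k / (2 ^ n * real n)))"
    by (simp add: field_simps)
  then have "?N * (1 - 4 / (real k / (2 ^ n * real n))) \<le> real (card ?good)"
    by (simp only: right_diff_distrib mult_1_right diff_le_eq)
  then show ?thesis
    unfolding splittable_fraction_def card_set_tuples
    by (subst pos_le_divide_eq) (simp_all add: mult.commute)
qed

theorem theorem4p6:
  fixes k :: "nat \<Rightarrow> nat"
  assumes "filterlim (\<lambda>n. real (k n) / (2 ^ n * real n)) at_top sequentially"
  shows "(\<lambda>n. splittable_fraction n (k n)) \<longlonglongrightarrow> 1"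
proof (rule tendsto_sandwich[where h = "\<lambda>_. 1"])
  let ?l = "\<lambda>n. real (k n) / (2 ^ n * real n)"
  \<comment> \<open>The lower bound needs \<open>4 \<le> ?l n\<close> and \<open>n > 0\<close>, so
    it holds only eventually, which suffices for the squeeze.\<close>
  have "\<forall>\<^sub>F n in sequentially. 4 \<le> ?l n" using assms by (simp add: filterlim_at_top)
  then show "\<forall>\<^sub>F n in sequentially. 1 - 4 / ?l n \<le> splittable_fraction n (k n)"
    using eventually_gt_at_top[of 0] by eventually_elim (rule splittable_fraction_ge)
  have "(\<lambda>n. 4 / ?l n) \<longlonglongrightarrow> 0"
    using assms by (intro tendsto_divide_0[OF tendsto_const] filterlim_at_top_imp_at_infinity)
  from tendsto_diff[OF tendsto_const this, of 1] show "(\<lambda>n. 1 - 4 / ?l n) \<longlonglongrightarrow> 1"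
    by (simp only: diff_0_right)
qed (simp_all add: splittable_fraction_le_1)

end
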